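(* Let $a,b$ be positive integers and let $d=\gcd(a,b)$. The affine curve $\{(x,y)\in\mathbb{C}^2 : T_b(x)=T_a(y)\}$ has exactly $\lfloor \frac d2\rfloor+1$ irreducible components, and exactly $\lfloor\frac{d-1}{2}\rfloor$ of them are Lissajous curves.
   Context: $T_n$ denotes the Chebyshev polynomial of the first kind: $T_0=1$, $T_1=t$, $T_{n+1}=2tT_n-T_{n-1}$, so that $T_n(\cos\theta)=\cos n\theta$. A Lissajous curve is a curve in $\mathbb{C}^2$ which, possibly after exchanging the coordinates $x$ and $y$, has the form $\{(\cos(pt),\cos(qt+\phi)) : t\in\mathbb{C}\}$ with $p,q$ coprime positive integers, $p$ odd, $\phi\in\mathbb{R}$ and $p\phi\notin\pi\mathbb{Z}$. *)

theory Defs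
  imports Complex_Main "HOL-Computational_Algebra.Polynomial"
begin

fun Cheb_poly :: "nat \<Rightarrow> complex poly" where
  "Cheb_poly 0 = 1"
| "Cheb_poly (Suc 0) = [:0, 1:]"
| "Cheb_poly (Suc (Suc n)) = 2 * [:0, 1:] * Cheb_poly (Suc n) - Cheb_poly n"

text \<open>
  Elements of \<^typ>\<open>complex poly poly\<close> serve as polynomials in two variables \<open>x\<close>, \<open>y\<close>: the outer
  variable is \<open>y\<close> and the coefficients are polynomials in \<open>x\<close>.
\<close>

definition poly_xy :: "complex poly poly \<Rightarrow> complex \<Rightarrow> complex \<Rightarrow> complex" where
  "poly_xy P x y = poly (poly P [:y:]) x"

definition zariski_closed :: "(complex \<times> complex) set \<Rightarrow> bool" where
  "zariski_closed Z \<longleftrightarrow> (\<exists>S. Z = {(x, y). \<forall>P\<in>S. poly_xy P x y = 0})"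

definition zariski_irreducible :: "(complex \<times> complex) set \<Rightarrow> bool" where
  "zariski_irreducible Z \<longleftrightarrow> zariski_closed Z \<and> Z \<noteq> {} \<and>
     (\<forall>A B. zariski_closed A \<longrightarrow> zariski_closed B \<longrightarrow> Z = A \<union> B \<longrightarrow> Z = A \<or> Z = B)"

definition irreducible_components :: "(complex \<times> complex) set \<Rightarrow> (complex \<times> complex) set set" where
  "irreducible_components X =
     {Z. zariski_irreducible Z \<and> Z \<subseteq> X \<and>
         (\<forall>W. zariski_irreducible W \<longrightarrow> W \<subseteq> X \<longrightarrow> Z \<subseteq> W \<longrightarrow> W = Z)}"

definition lissajous_param :: "nat \<Rightarrow> nat \<Rightarrow> real \<Rightarrow> (complex \<times> complex) set" where
  "lissajous_param p q \<phi> = range (\<lambda>t::complex. (cos (of_nat p * t), cos (of_nat q * t + of_real \<phi>)))"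

definition lissajous_curve :: "(complex \<times> complex) set \<Rightarrow> bool" where
  "lissajous_curve C \<longleftrightarrow>
     (\<exists>p q \<phi>. p > 0 \<and> q > 0 \<and> coprime p q \<and> odd p \<and> (\<nexists>k::int. real p * \<phi> = pi * of_int k) \<and>
        (C = lissajous_param p q \<phi> \<or> C = prod.swap ` lissajous_param p q \<phi>))"

definition Cheb_curve :: "nat \<Rightarrow> nat \<Rightarrow> (complex \<times> complex) set" where
  "Cheb_curve a b = {(x, y). poly (Cheb_poly b) x = poly (Cheb_poly a) y}"

end

theory Submission
  imports Defs "HOL-Complex_Analysis.Complex_Analysis"
begin

text \<open>
  Write \<open>a = d p\<close> and \<open>b = d q\<close>. Putting \<open>x = cos u\<close>, \<open>y = cos v\<close> turns \<open>T\<^sub>b(x) = T\<^sub>a(y)\<close> into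
  \<open>q u = \<plusminus>p v + 2\<pi>k/d\<close>, which splits the curve into the sets
  \<open>E\<^sub>k = {X\<^sup>2 + Y\<^sup>2 - 2XY cos \<delta> = sin\<^sup>2 \<delta>}\<close> with \<open>X = T\<^sub>q(x)\<close>, \<open>Y = T\<^sub>p(y)\<close>, \<open>\<delta> = 2\<pi>k/d\<close>,
  \<open>0 \<le> k \<le> d/2\<close>. As \<open>p\<close> and \<open>q\<close> are coprime, \<open>E\<^sub>k\<close> is the image of
  \<open>t \<mapsto> (cos (p t), cos (q t + \<delta>/p))\<close>. It is irreducible since a product of two entire functions
  vanishes only if a factor does.

  The Lissajous curves are exactly the sets of this kind with \<open>sin \<delta> \<noteq> 0\<close>. Those with
  \<open>sin \<delta> = 0\<close> (\<open>k = 0\<close> or \<open>2k = d\<close>) have generic fibres of size \<open>p\<close> and \<open>q\<close> over the \<open>x\<close>- and the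
  \<open>y\<close>-axis, whereas a Lissajous curve has generic fibres of even size over both axes; so coprimality
  of \<open>p\<close> and \<open>q\<close> rules them out.
\<close>

subsection \<open>The Zariski topology of the plane\<close>

lemma poly_xy_simps [simp]:
  "poly_xy 0 x y = 0" "poly_xy 1 x y = 1"
  "poly_xy (pCons p P) x y = poly p x + y * poly_xy P x y"
  "poly_xy (P + Q) x y = poly_xy P x y + poly_xy Q x y"
  "poly_xy (P - Q) x y = poly_xy P x y - poly_xy Q x y"
  "poly_xy (P * Q) x y = poly_xy P x y * poly_xy Q x y"
  by (simp_all add: poly_xy_def)

lemma poly_xy_const_y: "poly_xy (map_poly (\<lambda>c. [:c:]) q) x y = poly q y"
  by (induction q) (simp_all add: map_poly_pCons)

lemma zariski_closed_zero_set: "zariski_closed {(x, y). poly_xy P x y = 0}"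
  unfolding zariski_closed_def by (rule exI[of _ "{P}"]) simp

lemma zariski_closed_empty: "zariski_closed {}"
  using zariski_closed_zero_set[of 1] by simp

lemma zariski_closed_Int:
  assumes "zariski_closed A" "zariski_closed B"
  shows "zariski_closed (A \<inter> B)"
proof -
  obtain S T where "A = {(x, y). \<forall>P\<in>S. poly_xy P x y = 0}" "B = {(x, y). \<forall>P\<in>T. poly_xy P x y = 0}"
    using assms unfolding zariski_closed_def by blast
  then have "A \<inter> B = {(x, y). \<forall>P\<in>S \<union> T. poly_xy P x y = 0}" by auto
  then show ?thesis unfolding zariski_closed_def by blast
qed

lemma zariski_closed_Un:
  assumes "zariski_closed A" "zariski_closed B"
  shows "zariski_closed (A \<union> B)"
proof -
  obtain S T where A: "A = {(x, y). \<forall>P\<in>S. poly_xy P x y = 0}"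
    and B: "B = {(x, y). \<forall>P\<in>T. poly_xy P x y = 0}"
    using assms unfolding zariski_closed_def by blast
  have "A \<union> B = {(x, y). \<forall>R\<in>{P * Q |P Q. P \<in> S \<and> Q \<in> T}. poly_xy R x y = 0}"
    unfolding A B by (auto; metis mult_eq_0_iff poly_xy_simps(6))
  then show ?thesis unfolding zariski_closed_def by blast
qed

lemma zariski_closed_Union:
  assumes "finite F" "\<And>Z. Z \<in> F \<Longrightarrow> zariski_closed Z"
  shows "zariski_closed (\<Union>F)"
  using assms by (induction F) (auto simp: zariski_closed_empty intro!: zariski_closed_Un)

text \<open>Cutting \<open>W\<close> by one member and by the union of the others writes it as a
  union of two closed sets, so irreducibility makes one cut all of \<open>W\<close>.\<close>

lemma zariski_irreducible_subset_Union:
  assumes "finite F" "\<And>Z. Z \<in> F \<Longrightarrow> zariski_closed Z"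
    and "zariski_irreducible W" "W \<subseteq> \<Union>F"
  shows "\<exists>Z\<in>F. W \<subseteq> Z"
  using assms
proof (induction F)
  case empty
  then show ?case by (auto simp: zariski_irreducible_def)
next
  case (insert Z F)
  have "zariski_closed (W \<inter> Z)" "zariski_closed (W \<inter> \<Union>F)"
    using insert.prems insert.hyps
    by (auto simp: zariski_irreducible_def intro!: zariski_closed_Int zariski_closed_Union)
  moreover have "W = (W \<inter> Z) \<union> (W \<inter> \<Union>F)"
    using insert.prems by auto
  ultimately have "W = W \<inter> Z \<or> W = W \<inter> \<Union>F"
    using insert.prems(2) unfolding zariski_irreducible_def by blast
  then show ?case
    using insert.IH insert.prems by (metis inf.orderI insert_iff)
qed

text \<open>Reduces finding the components to exhibiting a finite antichain of irreducible sets: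
  every irreducible subset of the union lies in a member, so the members are the maximal
  ones.\<close>

lemma irreducible_components_Union:
  assumes fin: "finite F" and irr: "\<And>Z. Z \<in> F \<Longrightarrow> zariski_irreducible Z"
    and anti: "\<And>Z W. Z \<in> F \<Longrightarrow> W \<in> F \<Longrightarrow> Z \<subseteq> W \<Longrightarrow> Z = W"
  shows "irreducible_components (\<Union>F) = F"
proof -
  have sub: "\<exists>Z\<in>F. W \<subseteq> Z" if "zariski_irreducible W" "W \<subseteq> \<Union>F" for W
    using zariski_irreducible_subset_Union[OF fin _ that] irr
    by (auto simp: zariski_irreducible_def)
  show ?thesis
  proof (intro equalityI subsetI)
    fix Z assume "Z \<in> irreducible_components (\<Union>F)"
    then have Z: "zariski_irreducible Z" "Z \<subseteq> \<Union>F"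
      and max: "\<And>W. zariski_irreducible W \<Longrightarrow> W \<subseteq> \<Union>F \<Longrightarrow> Z \<subseteq> W \<Longrightarrow> W = Z"
      by (simp_all add: irreducible_components_def)
    obtain W where W: "W \<in> F" "Z \<subseteq> W" using sub[OF Z] by (rule bexE)
    have "W = Z" by (rule max[OF irr[OF W(1)] Union_upper[OF W(1)] W(2)])
    with W(1) show "Z \<in> F" by simp
  next
    fix Z assume Z: "Z \<in> F"
    have "W = Z" if W: "zariski_irreducible W" "W \<subseteq> \<Union>F" "Z \<subseteq> W" for W
    proof -
      obtain V where V: "V \<in> F" "W \<subseteq> V" using sub[OF W(1,2)] by (rule bexE)
      have "Z = V" by (rule anti[OF Z V(1) subset_trans[OF W(3) V(2)]])
      with V(2) W(3) show ?thesis by simp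
    qed
    then show "Z \<in> irreducible_components (\<Union>F)"
      unfolding irreducible_components_def using irr[OF Z] Union_upper[OF Z] by simp
  qed
qed

lemma holomorphic_on_poly_xy:
  assumes "f holomorphic_on S" "g holomorphic_on S"
  shows "(\<lambda>t. poly_xy P (f t) (g t)) holomorphic_on S"
proof (induction P)
  case (pCons p P)
  then show ?case by (auto intro!: holomorphic_intros assms)
qed simp

text \<open>The set where \<open>f\<close> is nonzero is open and nonempty, and \<open>g\<close>
  vanishes on it; the identity theorem spreads this to the whole plane.\<close>

lemma entire_mult_eq_0:
  fixes f g :: "complex \<Rightarrow> complex"
  assumes "f holomorphic_on UNIV" "g holomorphic_on UNIV" "\<And>z. f z * g z = 0" "f z \<noteq> 0"
  shows "g w = 0"
proof -
  have "open (f -` (- {0}))"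
    using assms(1) by (intro open_vimage) (auto intro: holomorphic_on_imp_continuous_on)
  moreover have "z \<in> f -` (- {0})" using assms(4) by simp
  moreover have "g t = 0" if "t \<in> f -` (- {0})" for t
    using assms(3)[of t] that by simp
  ultimately show ?thesis
    using analytic_continuation_open[of "f -` (- {0})" UNIV g "\<lambda>_. 0" w] assms(2) by auto
qed

text \<open>If both closed pieces were proper, each would have an equation failing somewhere on the
  curve. Pulled back along the parametrization, these become nonzero entire functions with product
  zero.\<close>

lemma zariski_irreducible_range:
  assumes "zariski_closed (range (\<lambda>t. (f t, g t)))" "f holomorphic_on UNIV" "g holomorphic_on UNIV"
  shows "zariski_irreducible (range (\<lambda>t. (f t, g t)))" (is "zariski_irreducible ?Z")
  unfolding zariski_irreducible_def
proof (intro conjI allI impI assms)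
  fix A B assume cl: "zariski_closed A" "zariski_closed B" and Z: "?Z = A \<union> B"
  obtain S T where A: "A = {(x, y). \<forall>P\<in>S. poly_xy P x y = 0}"
    and B: "B = {(x, y). \<forall>P\<in>T. poly_xy P x y = 0}"
    using cl unfolding zariski_closed_def by blast
  show "?Z = A \<or> ?Z = B"
  proof (rule ccontr)
    assume "\<not> ?thesis"
    then obtain s t where "(f s, g s) \<notin> A" "(f t, g t) \<notin> B" using Z by blast
    then obtain P Q where P: "P \<in> S" "poly_xy P (f s) (g s) \<noteq> 0"
      and Q: "Q \<in> T" "poly_xy Q (f t) (g t) \<noteq> 0"
      unfolding A B by auto
    have "poly_xy P (f u) (g u) * poly_xy Q (f u) (g u) = 0" for u
    proof -
      have "(f u, g u) \<in> A \<union> B" using Z by blast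
      then show ?thesis using P(1) Q(1) unfolding A B by auto
    qed
    then show False
      using entire_mult_eq_0[OF holomorphic_on_poly_xy holomorphic_on_poly_xy] assms(2,3) P(2) Q(2)
      by blast
  qed
qed auto

subsection \<open>Chebyshev polynomials and cosines\<close>

lemma poly_Cheb_poly_cos: "poly (Cheb_poly n) (cos t) = cos (of_nat n * t)"
proof (induction n rule: Cheb_poly.induct)
  case (3 n)
  have "cos (of_nat (Suc (Suc n)) * t) + cos (of_nat n * t) = 2 * cos t * cos (of_nat (Suc n) * t)"
    using cos_plus_cos[of "of_nat (Suc (Suc n)) * t" "of_nat n * t"]
    by (simp add: algebra_simps add_divide_distrib)
  with 3 show ?case by (simp add: algebra_simps)
qed auto

lemma complex_cos_eq_int:
  fixes w z :: complex
  shows "cos w = cos z \<longleftrightarrow> (\<exists>k::int. w = z + 2 * of_real pi * of_int k \<or> w = - z + 2 * of_real pi * of_int k)"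
  unfolding complex_cos_eq by (auto simp: Ints_def algebra_simps)

lemma complex_cos_surj:
  fixes z :: complex
  obtains t where "z = cos t"
  by (metis cos_Arccos)

text \<open>With \<open>y = cos v\<close> the equation says that \<open>n * v\<close> is
  \<open>w\<close> or \<open>-w\<close> modulo \<open>2 * pi\<close>; evenness of the cosine absorbs
  the sign, and only the shift modulo \<open>n\<close> matters.\<close>

lemma Cheb_poly_fibre:
  assumes "n > 0"
  shows "poly (Cheb_poly n) y = cos w \<longleftrightarrow> (\<exists>j<n. y = cos ((w + 2 * of_real pi * of_nat j) / of_nat n))"
    (is "_ \<longleftrightarrow> ?R")
proof
  obtain v where y: "y = cos v" by (rule complex_cos_surj)
  assume "poly (Cheb_poly n) y = cos w"
  then have "cos w = cos (of_nat n * v)" by (simp add: y poly_Cheb_poly_cos)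
  then obtain k :: int and e where e: "e = v \<or> e = - v" and k: "w = of_nat n * e + 2 * of_real pi * of_int k"
    unfolding complex_cos_eq_int by (metis mult_minus_right)
  \<comment> \<open>Since \<open>e = (w - 2 * pi * k) / n\<close>, the index is the residue of
    \<open>-k\<close>, not of \<open>k\<close>.\<close>
  define j where "j = nat ((- k) mod int n)"
  have "int j = (- k) mod int n" using assms by (simp add: j_def)
  moreover have "(- k) mod int n = - k - int n * ((- k) div int n)"
    by (simp add: minus_mult_div_eq_mod)
  ultimately have j: "(of_nat j :: complex) = - of_int k - of_nat n * of_int ((- k) div int n)"
    by (metis of_int_diff of_int_minus of_int_mult of_int_of_nat_eq)
  have "(w + 2 * of_real pi * of_nat j) / of_nat n = e + 2 * of_real pi * of_int (- ((- k) div int n))"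
    using assms unfolding j k by (simp add: field_simps)
  then have "cos ((w + 2 * of_real pi * of_nat j) / of_nat n) = cos e"
    unfolding complex_cos_eq_int by blast
  then have "y = cos ((w + 2 * of_real pi * of_nat j) / of_nat n)" using e y by auto
  moreover have "j < n" using assms by (simp add: j_def nat_less_iff)
  ultimately show ?R by blast
next
  assume ?R
  then obtain j where y: "y = cos ((w + 2 * of_real pi * of_nat j) / of_nat n)" by blast
  have "poly (Cheb_poly n) y = cos (w + 2 * of_real pi * of_nat j)"
    using assms by (simp add: y poly_Cheb_poly_cos)
  also have "\<dots> = cos w"
    unfolding complex_cos_eq_int by (rule exI[of _ "int j"]) simp
  finally show "poly (Cheb_poly n) y = cos w" .
qed

text \<open>Two of the \<open>n\<close> angles with equal cosines either agree modulo
  \<open>2 * pi\<close>, forcing equal indices, or are opposite, forcing \<open>w\<close> to be an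
  integer multiple of \<open>pi\<close>.\<close>

lemma card_Cheb_poly_fibre:
  assumes "n > 0" "sin w \<noteq> 0"
  shows "card {y. poly (Cheb_poly n) y = cos w} = n"
proof -
  let ?f = "\<lambda>j::nat. cos ((w + 2 * of_real pi * of_nat j) / of_nat n)"
  have "inj_on ?f {..<n}"
  proof (rule inj_onI)
    fix i j assume ij: "i \<in> {..<n}" "j \<in> {..<n}" "?f i = ?f j"
    then obtain k :: int where
      "(w + 2 * of_real pi * of_nat i) / of_nat n = (w + 2 * of_real pi * of_nat j) / of_nat n + 2 * of_real pi * of_int k
     \<or> (w + 2 * of_real pi * of_nat i) / of_nat n = - ((w + 2 * of_real pi * of_nat j) / of_nat n) + 2 * of_real pi * of_int k"
      unfolding complex_cos_eq_int by blast
    then show "i = j"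
    proof
      assume "(w + 2 * of_real pi * of_nat i) / of_nat n = (w + 2 * of_real pi * of_nat j) / of_nat n + 2 * of_real pi * of_int k"
      then have "2 * complex_of_real pi * of_nat i = 2 * complex_of_real pi * (of_nat j + of_nat n * of_int k)"
        using assms(1) by (simp add: field_simps)
      then have "(of_nat i :: complex) = of_nat j + of_nat n * of_int k" by simp
      then have "(of_int (int i) :: complex) = of_int (int j + int n * k)" by simp
      then have "int i = int j + int n * k" by (simp only: of_int_eq_iff)
      then have "int i mod int n = int j mod int n" by simp
      then show ?thesis using ij by simp
    next
      assume "(w + 2 * of_real pi * of_nat i) / of_nat n = - ((w + 2 * of_real pi * of_nat j) / of_nat n) + 2 * of_real pi * of_int k"
      then have "2 * w = 2 * (of_real pi * (of_nat n * of_int k - of_nat i - of_nat j))"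
        using assms(1) by (simp add: field_simps)
      then have "w = of_real (pi * of_int (int n * k - int i - int j))" by simp
      then have "sin w = of_real (sin (pi * of_int (int n * k - int i - int j)))"
        by (simp only: sin_of_real)
      then have "sin w = 0" by (simp only: sin_npi_int of_real_0)
      with assms(2) show ?thesis by simp
    qed
  qed
  moreover have "{y. poly (Cheb_poly n) y = cos w} = ?f ` {..<n}"
    unfolding Cheb_poly_fibre[OF assms(1)] by auto
  ultimately show ?thesis by (simp add: card_image)
qed

subsection \<open>Lissajous quadrics\<close>

text \<open>The pullback under \<open>X = T_q(x)\<close>, \<open>Y = T_p(y)\<close> of the conic
  traced by \<open>(cos s, cos (s + d))\<close>, where \<open>c = cos d\<close>. Taking
  \<open>c\<close> rather than \<open>d\<close> as parameter keeps the equation visibly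
  polynomial.\<close>

definition cheb_conic :: "nat \<Rightarrow> nat \<Rightarrow> complex \<Rightarrow> (complex \<times> complex) set" where
  "cheb_conic p q c = {(x, y). (poly (Cheb_poly q) x)\<^sup>2 + (poly (Cheb_poly p) y)\<^sup>2
     - 2 * c * poly (Cheb_poly q) x * poly (Cheb_poly p) y = 1 - c\<^sup>2}"

lemma cheb_conic_swap: "prod.swap ` cheb_conic p q c = cheb_conic q p c"
proof -
  have "prod.swap ` cheb_conic p q c = {(x, y). (y, x) \<in> cheb_conic p q c}"
    by (force simp: image_iff)
  also have "\<dots> = cheb_conic q p c"
    by (auto simp: cheb_conic_def algebra_simps)
  finally show ?thesis .
qed

lemma zariski_closed_cheb_conic: "zariski_closed (cheb_conic p q c)"
proof -
  define X Y where "X = [:Cheb_poly q:]" and "Y = map_poly (\<lambda>a. [:a:]) (Cheb_poly p)"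
  have "cheb_conic p q c = {(x, y). poly_xy (X * X + Y * Y - [:[:2 * c:]:] * X * Y - [:[:1 - c * c:]:]) x y = 0}"
    by (auto simp: cheb_conic_def X_def Y_def poly_xy_const_y power2_eq_square simp del: mult_pCons_left mult_pCons_right)
  then show ?thesis by (simp only: zariski_closed_zero_set)
qed

text \<open>As a quadratic in \<open>z\<close>, the equation has the two roots
  \<open>cos (s + d)\<close> and \<open>cos (s - d)\<close>.\<close>

lemma cos_conic_iff:
  fixes s z d :: complex
  shows "(cos s)\<^sup>2 + z\<^sup>2 - 2 * cos d * cos s * z = 1 - (cos d)\<^sup>2
    \<longleftrightarrow> z = cos (s + d) \<or> z = cos (s - d)"
proof -
  have "(cos s)\<^sup>2 + z\<^sup>2 - 2 * cos d * cos s * z - (1 - (cos d)\<^sup>2)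
      = (z - cos (s + d)) * (z - cos (s - d))"
    using sin_cos_squared_add[of s] sin_cos_squared_add[of d]
    unfolding cos_add cos_diff by algebra
  then show ?thesis by (metis eq_iff_diff_eq_0 mult_eq_0_iff)
qed

lemma cheb_conic_cos_iff:
  "(cos u, y) \<in> cheb_conic p q (cos d) \<longleftrightarrow>
     poly (Cheb_poly p) y = cos (of_nat q * u + d) \<or> poly (Cheb_poly p) y = cos (of_nat q * u - d)"
  by (simp add: cheb_conic_def poly_Cheb_poly_cos cos_conic_iff)

lemma lissajous_param_eq_cheb_conic:
  assumes "p > 0" "coprime p q"
  shows "lissajous_param p q \<phi> = cheb_conic p q (cos (of_real (real p * \<phi>)))"
proof (intro equalityI subsetI)
  fix z assume "z \<in> lissajous_param p q \<phi>"
  then obtain t where z: "z = (cos (of_nat p * t), cos (of_nat q * t + of_real \<phi>))"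
    by (auto simp: lissajous_param_def)
  show "z \<in> cheb_conic p q (cos (of_real (real p * \<phi>)))"
    unfolding z cheb_conic_cos_iff by (simp add: poly_Cheb_poly_cos algebra_simps)
next
  fix z assume z: "z \<in> cheb_conic p q (cos (of_real (real p * \<phi>)))"
  obtain u y where zu: "z = (cos u, y)" by (metis complex_cos_surj surj_pair)
  \<comment> \<open>Replacing \<open>u\<close> by \<open>-u\<close> keeps \<open>cos u\<close> and
    interchanges the two branches, so the branch with the plus sign can be assumed.\<close>
  obtain v where v: "cos v = cos u"
    and y: "poly (Cheb_poly p) y = cos (of_nat q * v + of_real (real p * \<phi>))"
  proof (cases "poly (Cheb_poly p) y = cos (of_nat q * u + of_real (real p * \<phi>))")
    case False
    then have "poly (Cheb_poly p) y = cos (of_nat q * u - of_real (real p * \<phi>))"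
      using z unfolding zu cheb_conic_cos_iff by blast
    also have "\<dots> = cos (of_nat q * (- u) + of_real (real p * \<phi>))"
      using cos_minus[of "of_nat q * u - of_real (real p * \<phi>)"] by simp
    finally show ?thesis using that[of "- u"] by simp
  qed (use that in blast)
  obtain j where j: "y = cos ((of_nat q * v + of_real (real p * \<phi>) + 2 * of_real pi * of_nat j) / of_nat p)"
    using y Cheb_poly_fibre[OF assms(1)] by blast
  \<comment> \<open>Coprimality enters here: with \<open>j = q * m - p * l\<close>, shifting
    \<open>v\<close> by \<open>2 * pi * m\<close> moves \<open>q * v / p\<close> by
    \<open>2 * pi * j / p\<close> up to a full period, so every choice of \<open>j\<close> is
    reached.\<close>
  obtain m' n' where "m' * int q + n' * int p = 1"
    using bezout_int[of "int q" "int p"] assms(2) by (auto simp: gcd.commute)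
  then have "int j = (m' * int q + n' * int p) * int j" by simp
  moreover define m l where "m = m' * int j" and "l = - (n' * int j)"
  ultimately have "int j = int q * m - int p * l" by (simp add: algebra_simps)
  then have jm: "(of_nat j :: complex) = of_nat q * of_int m - of_nat p * of_int l"
    by (metis of_int_diff of_int_mult of_int_of_nat_eq)
  define t where "t = (v + 2 * of_real pi * of_int m) / of_nat p"
  have "cos (of_nat p * t) = cos v"
    unfolding complex_cos_eq_int by (rule exI[of _ m]) (use assms(1) in \<open>simp add: t_def\<close>)
  moreover have "cos (of_nat q * t + of_real \<phi>) = y"
    unfolding j complex_cos_eq_int
    by (rule exI[of _ l]) (use assms(1) in \<open>simp add: t_def jm field_simps\<close>)
  ultimately have "z = (cos (of_nat p * t), cos (of_nat q * t + of_real \<phi>))"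
    using v zu by simp
  then show "z \<in> lissajous_param p q \<phi>"
    unfolding lissajous_param_def by blast
qed

lemma cheb_conic_eq_lissajous_param:
  assumes "p > 0" "coprime p q"
  shows "cheb_conic p q (cos (of_real d)) = lissajous_param p q (d / real p)"
  using lissajous_param_eq_cheb_conic[OF assms, of "d / real p"] assms(1) by simp

lemma zariski_irreducible_cheb_conic:
  assumes "p > 0" "coprime p q"
  shows "zariski_irreducible (cheb_conic p q (cos (of_real d)))"
proof -
  note eq = cheb_conic_eq_lissajous_param[OF assms, of d]
  then have "zariski_closed (lissajous_param p q (d / real p))"
    using zariski_closed_cheb_conic by metis
  then show ?thesis
    unfolding eq lissajous_param_def
    by (rule zariski_irreducible_range) (auto intro!: holomorphic_intros)
qed

text \<open>Supplies the antichain condition. Along the branch \<open>X = cos s\<close>,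
  \<open>Y = cos (s + d)\<close> both equations hold, and subtracting them leaves an identity in
  \<open>s\<close>.\<close>

lemma cheb_conic_subset_imp_eq:
  assumes "p > 0" "q > 0" and sub: "cheb_conic p q (cos d) \<subseteq> cheb_conic p q (cos e)"
  shows "cos d = cos e"
proof -
  have *: "2 * (cos s * cos (s + d)) * (cos d - cos e) = (cos d)\<^sup>2 - (cos e)\<^sup>2" for s
  proof -
    define x y where "x = cos (s / of_nat q)" and "y = cos ((s + d) / of_nat p)"
    have "poly (Cheb_poly q) x = cos s" "poly (Cheb_poly p) y = cos (s + d)"
      using assms(1,2) by (simp_all add: x_def y_def poly_Cheb_poly_cos)
    note XY = this
    have "(x, y) \<in> cheb_conic p q (cos d)"
      by (simp add: cheb_conic_def XY cos_conic_iff)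
    with sub have "(x, y) \<in> cheb_conic p q (cos d)" "(x, y) \<in> cheb_conic p q (cos e)" by auto
    then show ?thesis unfolding cheb_conic_def by (simp add: XY) algebra
  qed
  \<comment> \<open>At \<open>s = pi/2\<close> the left side vanishes, so the two cosines have equal
    squares; \<open>s = 0\<close> then gives \<open>cos d * (cos d - cos e) = 0\<close>.\<close>
  show ?thesis
    using *[of "0"] *[of "of_real pi / 2"] cos_of_real[of "pi/2"] by (auto simp: power2_eq_square)
qed

text \<open>At \<open>x = cos \<i>\<close> no branches meet, since all zeros of the sine are real.\<close>

lemma sin_imaginary_nonzero:
  assumes "q > 0"
  shows "sin (of_nat q * \<i> + of_real d) \<noteq> 0"
proof
  assume "sin (of_nat q * \<i> + of_real d) = 0"
  then obtain n where "of_nat q * \<i> + of_real d = of_real (n * pi)"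
    unfolding sin_eq_0 by (metis)
  then have "Im (of_nat q * \<i> + of_real d) = 0" by simp
  with assms show False by simp
qed

text \<open>The two branches over \<open>x = cos \<i>\<close> contribute \<open>p\<close> points
  each; they coincide when \<open>sin d = 0\<close> and are disjoint otherwise.\<close>

lemma card_cheb_conic_fibre:
  assumes "p > 0" "q > 0"
  shows "card {y. (cos \<i>, y) \<in> cheb_conic p q (cos (of_real d))} = (if sin d = 0 then p else 2 * p)"
proof -
  let ?w = "of_nat q * \<i> + of_real d" and ?w' = "of_nat q * \<i> - of_real d"
  let ?A = "{y. poly (Cheb_poly p) y = cos ?w}" and ?B = "{y. poly (Cheb_poly p) y = cos ?w'}"
  have cA: "card ?A = p" and cB: "card ?B = p"
    using card_Cheb_poly_fibre[OF assms(1)] sin_imaginary_nonzero[OF assms(2), of d]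
      sin_imaginary_nonzero[OF assms(2), of "- d"] by simp_all
  have "finite ?A" "finite ?B" using cA cB assms(1) card_gt_0_iff by metis+
  have U: "{y. (cos \<i>, y) \<in> cheb_conic p q (cos (of_real d))} = ?A \<union> ?B"
    unfolding cheb_conic_cos_iff by auto
  have "cos ?w' - cos ?w = 2 * sin (of_nat q * \<i>) * sin (of_real d)"
    by (simp add: cos_add cos_diff)
  then have eq: "cos ?w' = cos ?w \<longleftrightarrow> sin d = 0"
    using sin_imaginary_nonzero[OF assms(2), of 0] by (auto simp: sin_of_real)
  show ?thesis
  proof (cases "sin d = 0")
    case True
    then show ?thesis using U eq cA by simp
  next
    case False
    then have "?A \<inter> ?B = {}" using eq by auto
    then show ?thesis
      using U False card_Un_disjoint[OF \<open>finite ?A\<close> \<open>finite ?B\<close>] cA cB by simp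
  qed
qed

text \<open>One set might be described by different pairs of degrees. Fibre counts over both axes
  would give \<open>a = 2 * p\<close> and \<open>b = 2 * q\<close>, against coprimality.\<close>

lemma cheb_conic_eq_imp_sin_eq_0:
  assumes "p > 0" "q > 0" "a > 0" "b > 0" "coprime a b"
    and "cheb_conic p q (cos (of_real d)) = cheb_conic a b (cos (of_real e))" "sin e = 0"
  shows "sin d = 0"
proof (rule ccontr)
  assume "sin d \<noteq> 0"
  have "cheb_conic q p (cos (of_real d)) = cheb_conic b a (cos (of_real e))"
    using assms(6) cheb_conic_swap by metis
  then have "2 * p = a" "2 * q = b"
    using card_cheb_conic_fibre[of p q d] card_cheb_conic_fibre[of q p d]
      card_cheb_conic_fibre[of a b e] card_cheb_conic_fibre[of b a e] assms \<open>sin d \<noteq> 0\<close> by auto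
  with assms(5) show False by auto
qed

lemma lissajous_curve_iff:
  "lissajous_curve C \<longleftrightarrow> (\<exists>p q d. p > 0 \<and> q > 0 \<and> coprime p q \<and> sin d \<noteq> 0
     \<and> C = cheb_conic p q (cos (of_real d)))" (is "_ \<longleftrightarrow> ?R")
proof
  have sin_iff: "(\<nexists>k::int. d = pi * of_int k) \<longleftrightarrow> sin d \<noteq> 0" for d
    by (simp add: sin_zero_iff_int2 mult.commute)
  show ?R if C: "lissajous_curve C"
  proof -
    obtain p q \<phi> where *: "p > 0" "q > 0" "coprime p q" "sin (real p * \<phi>) \<noteq> 0"
      "C = lissajous_param p q \<phi> \<or> C = prod.swap ` lissajous_param p q \<phi>"
      using C unfolding lissajous_curve_def sin_iff by (elim exE conjE) (rule that)
    then have "C = cheb_conic p q (cos (of_real (real p * \<phi>))) \<or> C = cheb_conic q p (cos (of_real (real p * \<phi>)))"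
      by (simp add: lissajous_param_eq_cheb_conic cheb_conic_swap del: of_real_mult)
    with * show ?R by (metis coprime_commute)
  qed
  have odd: "lissajous_curve C"
    if "p > 0" "q > 0" "coprime p q" "sin d \<noteq> 0" "odd p"
      "C = cheb_conic p q (cos (of_real d)) \<or> C = prod.swap ` cheb_conic p q (cos (of_real d))" for p q d
  proof -
    have "real p * (d / real p) = d" using that(1) by simp
    then show ?thesis
      using that unfolding lissajous_curve_def sin_iff
      by (metis cheb_conic_eq_lissajous_param)
  qed
  assume ?R
  then obtain p q d where *: "p > 0" "q > 0" "coprime p q" "sin d \<noteq> 0"
     "C = cheb_conic p q (cos (of_real d))" by blast
  \<comment> \<open>The exchange of coordinates allowed in \<open>lissajous_curve\<close> lets the
    odd degree come first.\<close>
  then have "odd p \<or> odd q" by (metis coprime_common_divisor odd_one)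
  then show "lissajous_curve C"
    using odd[of p q d] odd[of q p d] * by (metis cheb_conic_swap coprime_commute)
qed

subsection \<open>The Chebyshev curve\<close>

text \<open>Periodicity reduces \<open>m\<close> to its residue modulo \<open>d\<close>, and
  evenness reflects a residue \<open>r\<close> above \<open>d div 2\<close> to
  \<open>d - r\<close>.\<close>

lemma cos_2pi_fraction_reduce:
  fixes m :: int
  assumes "d > 0"
  obtains k where "k \<le> d div 2" "cos (of_real (2 * pi * of_int m / real d)) = (cos (of_real (2 * pi * real k / real d)) :: complex)"
proof -
  define r where "r = nat (m mod int d)"
  have r: "int r = m mod int d" "r < d" using assms by (simp_all add: r_def nat_less_iff)
  define l where "l = m div int d"
  have "m = int r + int d * l" by (simp add: r(1) l_def)
  then have m: "real_of_int m = real r + real d * of_int l"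
    by (metis of_int_add of_int_mult of_int_of_nat_eq)
  show ?thesis
  proof (cases "r \<le> d div 2")
    case True
    have "complex_of_real (2 * pi * of_int m / real d) = of_real (2 * pi * real r / real d) + 2 * of_real pi * of_int l"
      using assms by (simp add: m field_simps)
    then show ?thesis using that[OF True] complex_cos_eq_int by blast
  next
    case False
    have "complex_of_real (2 * pi * of_int m / real d)
        = - of_real (2 * pi * real (d - r) / real d) + 2 * of_real pi * of_int (l + 1)"
      using assms r(2) by (simp add: m field_simps of_nat_diff)
    moreover have "d - r \<le> d div 2" using False by simp
    ultimately show ?thesis using that[of "d - r"] complex_cos_eq_int by blast
  qed
qed

lemma Cheb_curve_eq_Union:
  assumes "p > 0" "d > 0"
  shows "Cheb_curve (d * p) (d * q)
    = (\<Union>k\<le>d div 2. cheb_conic p q (cos (of_real (2 * pi * real k / real d))))"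
proof (intro equalityI subsetI)
  fix z assume z: "z \<in> Cheb_curve (d * p) (d * q)"
  obtain u v where zu: "z = (cos u, cos v)" by (metis complex_cos_surj surj_pair)
  have "cos (of_nat (d * p) * v) = cos (of_nat (d * q) * u)"
    using z by (simp add: zu Cheb_curve_def poly_Cheb_poly_cos)
  then obtain m :: int where m: "of_nat (d * p) * v = of_nat (d * q) * u + 2 * of_real pi * of_int m \<or>
      of_nat (d * p) * v = - (of_nat (d * q) * u) + 2 * of_real pi * of_int m"
    unfolding complex_cos_eq_int by blast
  let ?e = "complex_of_real (2 * pi * of_int m / real d)"
  have "of_nat p * v = of_nat q * u + ?e \<or> of_nat p * v = - (of_nat q * u - ?e)"
    using m assms(2) by (simp add: field_simps)
  then have "z \<in> cheb_conic p q (cos ?e)"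
    unfolding zu cheb_conic_cos_iff poly_Cheb_poly_cos by (metis cos_minus)
  then show "z \<in> (\<Union>k\<le>d div 2. cheb_conic p q (cos (of_real (2 * pi * real k / real d))))"
    using cos_2pi_fraction_reduce[OF assms(2), of m] by (metis UN_I atMost_iff)
next
  fix z assume "z \<in> (\<Union>k\<le>d div 2. cheb_conic p q (cos (of_real (2 * pi * real k / real d))))"
  then obtain k where z: "z \<in> cheb_conic p q (cos (of_real (2 * pi * real k / real d)))" by blast
  obtain u v where zu: "z = (cos u, cos v)" by (metis complex_cos_surj surj_pair)
  let ?e = "complex_of_real (2 * pi * real k / real d)"
  have "cos (of_nat p * v) = cos (of_nat q * u + ?e) \<or> cos (of_nat p * v) = cos (of_nat q * u - ?e)"
    using z unfolding zu cheb_conic_cos_iff poly_Cheb_poly_cos .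
  \<comment> \<open>Applying \<open>T_d\<close> multiplies the angles by \<open>d\<close> and turns
    the phase \<open>?e\<close> into the full period \<open>2 * pi * k\<close>.\<close>
  then have "poly (Cheb_poly d) (cos (of_nat p * v)) = poly (Cheb_poly d) (cos (of_nat q * u + ?e))
    \<or> poly (Cheb_poly d) (cos (of_nat p * v)) = poly (Cheb_poly d) (cos (of_nat q * u - ?e))"
    by auto
  moreover have "of_nat d * (of_nat q * u + ?e) = of_nat (d * q) * u + 2 * of_real pi * of_int (int k)"
    "of_nat d * (of_nat q * u - ?e) = of_nat (d * q) * u + 2 * of_real pi * of_int (- int k)"
    using assms(2) by (simp_all add: field_simps)
  ultimately have "cos (of_nat (d * p) * v) = cos (of_nat (d * q) * u)"
    unfolding poly_Cheb_poly_cos using complex_cos_eq_int[of _ "of_nat (d * q) * u"]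
    by (metis mult.assoc of_nat_mult)
  then show "z \<in> Cheb_curve (d * p) (d * q)"
    by (simp add: zu Cheb_curve_def poly_Cheb_poly_cos)
qed

theorem corollary9:
  fixes a b d :: nat
  assumes "a > 0" and "b > 0" and "d = gcd a b"
  shows "card (irreducible_components (Cheb_curve a b)) = d div 2 + 1 \<and>
         card {C \<in> irreducible_components (Cheb_curve a b). lissajous_curve C} = (d - 1) div 2"
proof -
  define p q where "p = a div d" and "q = b div d"
  have d: "d > 0" using assms by simp
  have ab: "a = d * p" "b = d * q" by (simp_all add: p_def q_def assms(3))
  have pq: "p > 0" "q > 0" using assms(1,2) ab by auto
  have cop: "coprime p q" unfolding p_def q_def assms(3) using assms(1) by (intro div_gcd_coprime) simp
  define e where "e k = 2 * pi * real k / real d" for k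
  define E where "E k = cheb_conic p q (cos (of_real (e k)))" for k
  \<comment> \<open>On this interval the cosine is injective, which separates the conics, and the
    sine vanishes only at the endpoints.\<close>
  have e_range: "0 \<le> e k" "e k \<le> pi" if "k \<le> d div 2" for k
  proof -
    have "real (2 * k) \<le> real d" using that by linarith
    then show "e k \<le> pi" using d by (simp add: e_def field_simps)
  qed (simp add: e_def)
  have sub: "k = l" if "k \<le> d div 2" "l \<le> d div 2" "E k \<subseteq> E l" for k l
  proof -
    have "complex_of_real (cos (e k)) = of_real (cos (e l))"
      using cheb_conic_subset_imp_eq[OF pq that(3)[unfolded E_def]] by (simp only: cos_of_real)
    then have "cos (e k) = cos (e l)" by (simp only: of_real_eq_iff)
    then have "e k = e l" by (rule cos_inj_pi[OF e_range[OF that(1)] e_range[OF that(2)]])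
    then show ?thesis using d by (simp add: e_def)
  qed
  have inj: "inj_on E {..d div 2}" by (rule inj_onI) (use sub in auto)
  have "irreducible_components (\<Union>(E ` {..d div 2})) = E ` {..d div 2}"
    using sub zariski_irreducible_cheb_conic[OF pq(1) cop]
    by (intro irreducible_components_Union) (auto simp: E_def)
  then have comp: "irreducible_components (Cheb_curve a b) = E ` {..d div 2}"
    unfolding ab Cheb_curve_eq_Union[OF pq(1) d] E_def e_def by simp
  have sin_e: "sin (e k) = 0 \<longleftrightarrow> k = 0 \<or> 2 * k = d" if "k \<le> d div 2" for k
  proof
    assume "sin (e k) = 0"
    then have "\<not> (0 < e k \<and> e k < pi)" using sin_gt_zero by force
    then have "e k = 0 \<or> e k = pi" using e_range[OF that] by linarith
    then have "k = 0 \<or> real (2 * k) = real d" using d by (auto simp: e_def field_simps)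
    then show "k = 0 \<or> 2 * k = d" by (simp only: of_nat_eq_iff)
  next
    assume "k = 0 \<or> 2 * k = d"
    then have "e k = 0 \<or> e k = pi" using d by (auto simp: e_def)
    then show "sin (e k) = 0" by auto
  qed
  have liss: "lissajous_curve (E k) \<longleftrightarrow> sin (e k) \<noteq> 0" for k
    unfolding lissajous_curve_iff E_def
    using cheb_conic_eq_imp_sin_eq_0 pq cop by metis
  have "{C \<in> E ` {..d div 2}. lissajous_curve C} = E ` {k \<in> {..d div 2}. sin (e k) \<noteq> 0}"
    using liss by auto
  \<comment> \<open>The index \<open>0\<close> always drops out and \<open>d div 2\<close> only for
    even \<open>d\<close>; the bound \<open>(d - 1) div 2\<close> covers both parities.\<close>
  also have "{k \<in> {..d div 2}. sin (e k) \<noteq> 0} = {1..(d - 1) div 2}"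
    using sin_e by auto
  finally have L: "{C \<in> E ` {..d div 2}. lissajous_curve C} = E ` {1..(d - 1) div 2}" .
  have "{1..(d - 1) div 2} \<subseteq> {..d div 2}" by auto
  then have "card (E ` {1..(d - 1) div 2}) = (d - 1) div 2"
    using card_image[OF inj_on_subset[OF inj]] by simp
  then show ?thesis unfolding comp L using inj by (simp add: card_image)
qed

end
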